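(* Let $N=1$. For any two states $\boldsymbol U_l,\boldsymbol U_r$ of the single-component compressible Euler equations with the stiffened equation of state (with $\rho_1>0$, $T>0$), put $\boldsymbol z=(z_1,z_2,z_3,z_4,z_5)^{\mathrm T}=(\rho_1,v_1,v_2,v_3,1/T)^{\mathrm T}$ and define $\widetilde{\boldsymbol U}=\widetilde{\boldsymbol U}(\boldsymbol U_l,\boldsymbol U_r)\in\mathbb R^5$ and $\widetilde{\boldsymbol F}_1=\widetilde{\boldsymbol F}_1(\boldsymbol U_l,\boldsymbol U_r)\in\mathbb R^5$ componentwise by $$\widetilde U_1=\{z_1\}^{\ln},\qquad \widetilde U_m=\{z_m\}\{z_1\}^{\ln}\ (m=2,3,4),$$ $$\widetilde U_5=\Big(\frac{c_{v,1}}{\{z_5\}^{\ln}}-\frac12\sum_{m=2}^4\{z_m^2\}\Big)\{z_1\}^{\ln}+\{z_1\}^{\ln}\sum_{m=2}^4\{z_m\}^2+p_{\infty,1},$$ and $$\widetilde F_{1,1}=\{z_1\}^{\ln}\{z_2\},\qquad \widetilde F_{1,2}=\{z_2\}\widetilde F_{1,1}+\frac{R_1\{z_1\}}{\{z_5\}}-p_{\infty,1},\qquad \widetilde F_{1,3}=\{z_3\}\widetilde F_{1,1},\qquad \widetilde F_{1,4}=\{z_4\}\widetilde F_{1,1},$$ $$\widetilde F_{1,5}=\Big(\frac{c_{v,1}}{\{z_5\}^{\ln}}-\frac12\sum_{m=2}^4\{z_m^2\}\Big)\widetilde F_{1,1}+\sum_{m=2}^4\{z_m\}\widetilde F_{1,m}+p_{\infty,1}\{z_2\}.$$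 Then $\widetilde{\boldsymbol U}$ and $\widetilde{\boldsymbol F}_1$ are symmetric in $(\boldsymbol U_l,\boldsymbol U_r)$, consistent with $\boldsymbol U$ and $\boldsymbol F_1$ respectively (that is, $\widetilde{\boldsymbol U}(\boldsymbol U,\boldsymbol U)=\boldsymbol U$ and $\widetilde{\boldsymbol F}_1(\boldsymbol U,\boldsymbol U)=\boldsymbol F_1(\boldsymbol U)$), and satisfy $$\big(\boldsymbol V(\boldsymbol U_r)-\boldsymbol V(\boldsymbol U_l)\big)^{\mathrm T}\widetilde{\boldsymbol U}=\phi(\boldsymbol U_r)-\phi(\boldsymbol U_l),\qquad \big(\boldsymbol V(\boldsymbol U_r)-\boldsymbol V(\boldsymbol U_l)\big)^{\mathrm T}\widetilde{\boldsymbol F}_1=\psi_1(\boldsymbol U_r)-\psi_1(\boldsymbol U_l).$$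
   Context: The three-dimensional single-component compressible Euler equations are $\partial_t\boldsymbol U+\sum_{k=1}^3\partial_{x_k}\boldsymbol F_k(\boldsymbol U)=0$ with $\boldsymbol U=(\rho_1,\rho_1 v_1,\rho_1 v_2,\rho_1 v_3,E)^{\mathrm T}$ and $\boldsymbol F_k=(\rho_1 v_k,\ \rho_1 v_k\boldsymbol v^{\mathrm T}+p\,\boldsymbol e_k^{\mathrm T},\ (E+p)v_k)^{\mathrm T}$, where $\rho_1$ is the density, $\boldsymbol v=(v_1,v_2,v_3)^{\mathrm T}$ the velocity, $\boldsymbol e_k$ the $k$th column of the $3\times3$ identity matrix, and $E=\rho_1 e+\frac12\rho_1|\boldsymbol v|^2$ the total energy. Stiffened equation of state: $\rho_1 e=c_{v,1}\rho_1T+p_{\infty,1}$ and $p=\rho_1R_1T-p_{\infty,1}$, where $T$ is the temperature, $c_{v,1}>0$ is the specific heat at constant volume, $\Gamma_1$ the adiabatic index, $R_1=c_{v,1}(\Gamma_1-1)$, and $p_{\infty,1}$ a material constant. States are assumed to satisfy $\rho_1>0$, $T>0$. Thermodynamic entropy: $S_1=c_{v,1}\ln T-R_1\ln\rho_1$. Entropy pair: $\eta(\boldsymbol U)=-\rho_1S_1$, $q_k(\boldsymbol U)=\eta v_k$. Entropy variables: $$\boldsymbol V=\eta'(\boldsymbol U)^{\mathrm T}=\Big(-S_1-\frac{|\boldsymbol v|^2}{2T}+c_{v,1}\Gamma_1,\ \frac{\boldsymbol v^{\mathrm T}}{T},\ -\frac1T\Big)^{\mathrm T}.$$ Entropy potential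 and entropy potential fluxes: $\phi=\boldsymbol V^{\mathrm T}\boldsymbol U-\eta=R_1\rho_1-p_{\infty,1}/T$ and $\psi_k=\boldsymbol V^{\mathrm T}\boldsymbol F_k-q_k=\phi v_k$. For a quantity $a$ with values $a_l,a_r$ at the left and right states: $\{a\}=\frac12(a_l+a_r)$ is the arithmetic mean (so $\{z_m^2\}=\frac12((z_m)_l^2+(z_m)_r^2)$), and for $a>0$, $\{a\}^{\ln}=(a_r-a_l)/(\ln a_r-\ln a_l)$ is the logarithmic mean, interpreted as $a_l$ when $a_l=a_r$. *)

theory Defs
  imports "HOL-Analysis.Analysis"
begin

(* Conserved states are vectors U = (rho, rho v1, rho v2, rho v3, E) in real^5.  In the index
   type 5 the numeral 5 denotes the same element as 0, so index sets are written out
   explicitly instead of as intervals.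
   Parameters: cv is the specific heat at constant volume, Gam the adiabatic index, and pinf
   the material constant of the stiffened equation of state. *)

section \<open>Euler equations with the stiffened equation of state\<close>

definition gas_const :: "real \<Rightarrow> real \<Rightarrow> real" where
  "gas_const cv Gam = cv * (Gam - 1)"

definition mass_density :: "real^5 \<Rightarrow> real" where
  "mass_density U = U $ 1"

definition velocity :: "real^5 \<Rightarrow> real^3" where
  "velocity U = vector [U $ 2 / U $ 1, U $ 3 / U $ 1, U $ 4 / U $ 1]"

definition total_energy :: "real^5 \<Rightarrow> real" where
  "total_energy U = U $ 5"

(* rho e, recovered from E = rho e + rho |v|^2 / 2 *)
definition internal_energy :: "real^5 \<Rightarrow> real" where
  "internal_energy U = total_energy U - mass_density U * (norm (velocity U))\<^sup>2 / 2"

(* rho e = cv rho T + pinf, solved for T *)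
definition temperature :: "real \<Rightarrow> real \<Rightarrow> real^5 \<Rightarrow> real" where
  "temperature cv pinf U = (internal_energy U - pinf) / (cv * mass_density U)"

definition pressure :: "real \<Rightarrow> real \<Rightarrow> real \<Rightarrow> real^5 \<Rightarrow> real" where
  "pressure cv Gam pinf U = mass_density U * gas_const cv Gam * temperature cv pinf U - pinf"

definition admissible :: "real \<Rightarrow> real \<Rightarrow> (real^5) set" where
  "admissible cv pinf = {U. mass_density U > 0 \<and> temperature cv pinf U > 0}"

definition flux :: "real \<Rightarrow> real \<Rightarrow> real \<Rightarrow> 3 \<Rightarrow> real^5 \<Rightarrow> real^5" where
  "flux cv Gam pinf k U =
    (let \<rho> = mass_density U; v = velocity U; p = pressure cv Gam pinf U; e = axis k 1 :: real^3 in
      vector [\<rho> * v $ k,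
              \<rho> * v $ k * v $ 1 + p * e $ 1,
              \<rho> * v $ k * v $ 2 + p * e $ 2,
              \<rho> * v $ k * v $ 3 + p * e $ 3,
              (total_energy U + p) * v $ k])"

section \<open>Entropy pair, entropy variables and potentials\<close>

definition thermo_entropy :: "real \<Rightarrow> real \<Rightarrow> real \<Rightarrow> real^5 \<Rightarrow> real" where
  "thermo_entropy cv Gam pinf U =
    cv * ln (temperature cv pinf U) - gas_const cv Gam * ln (mass_density U)"

definition entropy :: "real \<Rightarrow> real \<Rightarrow> real \<Rightarrow> real^5 \<Rightarrow> real" where
  "entropy cv Gam pinf U = - mass_density U * thermo_entropy cv Gam pinf U"

definition entropy_flux :: "real \<Rightarrow> real \<Rightarrow> real \<Rightarrow> 3 \<Rightarrow> real^5 \<Rightarrow> real" where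
  "entropy_flux cv Gam pinf k U = entropy cv Gam pinf U * velocity U $ k"

(* The gradient of the entropy; the closed form is entropy_vars_eq below. *)
definition entropy_vars :: "real \<Rightarrow> real \<Rightarrow> real \<Rightarrow> real^5 \<Rightarrow> real^5" where
  "entropy_vars cv Gam pinf U =
    (\<chi> i. frechet_derivative (entropy cv Gam pinf) (at U) (axis i 1))"

definition potential :: "real \<Rightarrow> real \<Rightarrow> real \<Rightarrow> real^5 \<Rightarrow> real" where
  "potential cv Gam pinf U = entropy_vars cv Gam pinf U \<bullet> U - entropy cv Gam pinf U"

definition potential_flux :: "real \<Rightarrow> real \<Rightarrow> real \<Rightarrow> 3 \<Rightarrow> real^5 \<Rightarrow> real" where
  "potential_flux cv Gam pinf k U =
    entropy_vars cv Gam pinf U \<bullet> flux cv Gam pinf k U - entropy_flux cv Gam pinf k U"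

section \<open>Means and two-point functions\<close>

definition arith_mean :: "real \<Rightarrow> real \<Rightarrow> real" where
  "arith_mean a b = (a + b) / 2"

definition log_mean :: "real \<Rightarrow> real \<Rightarrow> real" where
  "log_mean a b = (if a = b then a else (b - a) / (ln b - ln a))"

definition zvars :: "real \<Rightarrow> real \<Rightarrow> real^5 \<Rightarrow> real^5" where
  "zvars cv pinf U = vector [mass_density U, velocity U $ 1, velocity U $ 2, velocity U $ 3,
                             1 / temperature cv pinf U]"

definition mean_z :: "real \<Rightarrow> real \<Rightarrow> real^5 \<Rightarrow> real^5 \<Rightarrow> 5 \<Rightarrow> real" where
  "mean_z cv pinf Ul Ur m = arith_mean (zvars cv pinf Ul $ m) (zvars cv pinf Ur $ m)"

definition mean_z_sq :: "real \<Rightarrow> real \<Rightarrow> real^5 \<Rightarrow> real^5 \<Rightarrow> 5 \<Rightarrow> real" where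
  "mean_z_sq cv pinf Ul Ur m =
    arith_mean ((zvars cv pinf Ul $ m)\<^sup>2) ((zvars cv pinf Ur $ m)\<^sup>2)"

definition log_mean_z :: "real \<Rightarrow> real \<Rightarrow> real^5 \<Rightarrow> real^5 \<Rightarrow> 5 \<Rightarrow> real" where
  "log_mean_z cv pinf Ul Ur m = log_mean (zvars cv pinf Ul $ m) (zvars cv pinf Ur $ m)"

definition U_tilde :: "real \<Rightarrow> real \<Rightarrow> real^5 \<Rightarrow> real^5 \<Rightarrow> real^5" where
  "U_tilde cv pinf Ul Ur =
    (let z = mean_z cv pinf Ul Ur; zsq = mean_z_sq cv pinf Ul Ur; zln = log_mean_z cv pinf Ul Ur in
      vector [zln 1,
              z 2 * zln 1,
              z 3 * zln 1,
              z 4 * zln 1,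
              (cv / zln 5 - 1 / 2 * (\<Sum>m\<in>{2,3,4}. zsq m)) * zln 1
                + zln 1 * (\<Sum>m\<in>{2,3,4}. (z m)\<^sup>2) + pinf])"

definition F1_tilde :: "real \<Rightarrow> real \<Rightarrow> real \<Rightarrow> real^5 \<Rightarrow> real^5 \<Rightarrow> real^5" where
  "F1_tilde cv Gam pinf Ul Ur =
    (let z = mean_z cv pinf Ul Ur; zsq = mean_z_sq cv pinf Ul Ur; zln = log_mean_z cv pinf Ul Ur;
         f1 = zln 1 * z 2;
         f2 = z 2 * f1 + gas_const cv Gam * z 1 / z 5 - pinf;
         f3 = z 3 * f1;
         f4 = z 4 * f1;
         f5 = (cv / zln 5 - 1 / 2 * (\<Sum>m\<in>{2,3,4}. zsq m)) * f1
                + (z 2 * f2 + z 3 * f3 + z 4 * f4) + pinf * z 2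
     in vector [f1, f2, f3, f4, f5])"

section \<open>Closed forms of the entropy variables and potentials\<close>

lemma UNIV_5: "(UNIV :: 5 set) = {1, 2, 3, 4, 5}"
proof (rule sym, rule card_subset_eq)
  show "card {1, 2, 3, 4, 5 :: 5} = card (UNIV :: 5 set)"
    by simp
qed auto

lemma vector_5 [simp]:
  "(vector [a, b, c, d, e] :: real^5) $ 1 = a"
  "(vector [a, b, c, d, e] :: real^5) $ 2 = b"
  "(vector [a, b, c, d, e] :: real^5) $ 3 = c"
  "(vector [a, b, c, d, e] :: real^5) $ 4 = d"
  "(vector [a, b, c, d, e] :: real^5) $ 5 = e"
  by (simp_all add: vector_def)

lemma sum_5: "sum f (UNIV :: 5 set) = f 1 + f 2 + f 3 + f 4 + f 5"
  for f :: "5 \<Rightarrow> real"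
  unfolding UNIV_5 by simp

lemma inner_5: "x \<bullet> y = x $ 1 * y $ 1 + x $ 2 * y $ 2 + x $ 3 * y $ 3 + x $ 4 * y $ 4 + x $ 5 * y $ 5"
  for x y :: "real^5"
  unfolding inner_vec_def sum_5 inner_real_def ..

lemma norm_sq_3: "(norm v)\<^sup>2 = (v $ 1)\<^sup>2 + (v $ 2)\<^sup>2 + (v $ 3)\<^sup>2" for v :: "real^3"
  unfolding power2_norm_eq_inner inner_vec_def sum_3 unfolding inner_real_def power2_eq_square ..

lemma norm_velocity_sq:
  "(norm (velocity U))\<^sup>2 = (U $ 2 / U $ 1)\<^sup>2 + (U $ 3 / U $ 1)\<^sup>2 + (U $ 4 / U $ 1)\<^sup>2"
  unfolding norm_sq_3 velocity_def by simp

lemma total_energy_eq: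
  assumes "cv > 0" "U \<in> admissible cv pinf"
  shows "total_energy U =
    cv * mass_density U * temperature cv pinf U + pinf + mass_density U * (norm (velocity U))\<^sup>2 / 2"
  using assms by (simp add: temperature_def internal_energy_def admissible_def field_simps)

lemma entropy_has_derivative:
  assumes cv: "cv > 0" and U: "U \<in> admissible cv pinf"
  defines "v \<equiv> velocity U" and "T \<equiv> temperature cv pinf U"
  shows "(entropy cv Gam pinf has_derivative (\<lambda>h. h \<bullet> vector
      [- thermo_entropy cv Gam pinf U - (norm v)\<^sup>2 / (2 * T) + cv * Gam,
       v $ 1 / T, v $ 2 / T, v $ 3 / T, - 1 / T])) (at U)"
proof -
  have rho: "U $ 1 > 0" and T: "T > 0"
    using U by (simp_all add: admissible_def mass_density_def T_def)
  let ?r = "U $ 1"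
  define Q where "Q X = (X $ 2)\<^sup>2 + (X $ 3)\<^sup>2 + (X $ 4)\<^sup>2" for X :: "real^5"
  define dQ where "dQ h = 2 * (U $ 2 * h $ 2 + U $ 3 * h $ 3 + U $ 4 * h $ 4)" for h :: "real^5"
  define N where "N X = X $ 5 - Q X / (2 * X $ 1) - pinf" for X
  define dN where "dN h = h $ 5 - dQ h / (2 * ?r) + Q U * h $ 1 / (2 * ?r\<^sup>2)" for h
  define dT where "dT h = dN h / (cv * ?r) - T * h $ 1 / ?r" for h
  have ne: "cv \<noteq> 0" "?r \<noteq> 0" "T \<noteq> 0" using cv rho T by auto
  have comp: "((\<lambda>X::real^5. X $ i) has_derivative (\<lambda>h. h $ i)) (at U)" for i
    by (rule bounded_linear_imp_has_derivative[OF bounded_linear_vec_nth])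
  have temp: "temperature cv pinf X = N X / (cv * X $ 1)" for X
  proof (cases "X $ 1 = 0")
    case False
    have "(norm (velocity X))\<^sup>2 = Q X / (X $ 1)\<^sup>2"
      by (simp add: norm_velocity_sq Q_def power_divide add_divide_distrib)
    then show ?thesis
      using False by (simp add: N_def temperature_def internal_energy_def mass_density_def
        total_energy_def power2_eq_square)
  qed (simp add: temperature_def mass_density_def)
  have "(Q has_derivative (\<lambda>h. (U $ 2 * h $ 2 + h $ 2 * U $ 2) + (U $ 3 * h $ 3 + h $ 3 * U $ 3)
      + (U $ 4 * h $ 4 + h $ 4 * U $ 4))) (at U)"
    unfolding Q_def[abs_def] power2_eq_square
    by (intro has_derivative_add has_derivative_mult comp)
  also have "(\<lambda>h. (U $ 2 * h $ 2 + h $ 2 * U $ 2) + (U $ 3 * h $ 3 + h $ 3 * U $ 3)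
      + (U $ 4 * h $ 4 + h $ 4 * U $ 4)) = dQ"
    by (simp add: fun_eq_iff dQ_def)
  finally have "(N has_derivative (\<lambda>h. h $ 5
      - (dQ h * (2 * ?r) - Q U * (2 * h $ 1)) / ((2 * ?r) * (2 * ?r)) - 0)) (at U)"
    unfolding N_def[abs_def]
    by (intro has_derivative_diff has_derivative_divide' has_derivative_mult_right comp
        has_derivative_const) (use ne in auto)
  also have "(\<lambda>h. h $ 5 - (dQ h * (2 * ?r) - Q U * (2 * h $ 1)) / ((2 * ?r) * (2 * ?r)) - 0) = dN"
    using ne by (simp add: fun_eq_iff dN_def diff_divide_distrib power2_eq_square)
  finally have "(temperature cv pinf has_derivative
      (\<lambda>h. (dN h * (cv * ?r) - N U * (cv * h $ 1)) / ((cv * ?r) * (cv * ?r)))) (at U)"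
    unfolding temp[abs_def]
    by (intro has_derivative_divide' has_derivative_mult_right comp) (use ne in auto)
  also have "(\<lambda>h. (dN h * (cv * ?r) - N U * (cv * h $ 1)) / ((cv * ?r) * (cv * ?r))) = dT"
    using ne by (simp add: fun_eq_iff dT_def T_def temp diff_divide_distrib)
  finally have temp': "(temperature cv pinf has_derivative dT) (at U)" .
  have "(thermo_entropy cv Gam pinf has_derivative
      (\<lambda>h. cv * (dT h * inverse T) - gas_const cv Gam * (h $ 1 * inverse ?r))) (at U)"
    unfolding thermo_entropy_def[abs_def] mass_density_def
    by (intro has_derivative_diff has_derivative_mult_right comp
        has_derivative_ln[OF _ temp', folded T_def] has_derivative_ln T rho)
  then have ent: "(entropy cv Gam pinf has_derivative
      (\<lambda>h. - ?r * (cv * (dT h * inverse T) - gas_const cv Gam * (h $ 1 * inverse ?r))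
        + - h $ 1 * thermo_entropy cv Gam pinf U)) (at U)"
    unfolding entropy_def[abs_def] mass_density_def
    by (intro has_derivative_mult has_derivative_minus comp)
  have "- ?r * (cv * (dT h * inverse T) - gas_const cv Gam * (h $ 1 * inverse ?r))
        + - h $ 1 * thermo_entropy cv Gam pinf U
    = h \<bullet> vector [- thermo_entropy cv Gam pinf U - (norm v)\<^sup>2 / (2 * T) + cv * Gam,
       v $ 1 / T, v $ 2 / T, v $ 3 / T, - 1 / T]" (is "?lhs = ?rhs") for h
  proof -
    have "?r * (cv * (dT h * inverse T)) = dN h / T - cv * h $ 1"
      using ne by (simp add: dT_def field_simps)
    moreover have "?r * (gas_const cv Gam * (h $ 1 * inverse ?r)) = cv * Gam * h $ 1 - cv * h $ 1"
      using ne by (simp add: gas_const_def field_simps)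
    ultimately have "?lhs = - dN h / T + cv * Gam * h $ 1 - h $ 1 * thermo_entropy cv Gam pinf U"
      by (simp add: right_diff_distrib)
    moreover have "(norm v)\<^sup>2 = Q U / ?r\<^sup>2"
      by (simp add: v_def norm_velocity_sq Q_def power_divide add_divide_distrib)
    moreover have "v $ 1 = U $ 2 / ?r" "v $ 2 = U $ 3 / ?r" "v $ 3 = U $ 4 / ?r"
      by (simp_all add: v_def velocity_def)
    ultimately show ?thesis
      by (simp add: inner_5 dN_def dQ_def algebra_simps add_divide_distrib diff_divide_distrib)
  qed
  then show ?thesis using ent by simp
qed

lemma entropy_vars_eq:
  assumes "cv > 0" "U \<in> admissible cv pinf"
  defines "v \<equiv> velocity U" and "T \<equiv> temperature cv pinf U"
  shows "entropy_vars cv Gam pinf U = vector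
      [- thermo_entropy cv Gam pinf U - (norm v)\<^sup>2 / (2 * T) + cv * Gam,
       v $ 1 / T, v $ 2 / T, v $ 3 / T, - 1 / T]"
  unfolding entropy_vars_def v_def T_def
    frechet_derivative_at[OF entropy_has_derivative[OF assms(1,2)], symmetric]
  by (simp add: vec_eq_iff inner_axis')

lemma conserved_components:
  assumes "U \<in> admissible cv pinf"
  shows "U $ 2 = mass_density U * velocity U $ 1" "U $ 3 = mass_density U * velocity U $ 2"
    "U $ 4 = mass_density U * velocity U $ 3"
  using assms by (simp_all add: admissible_def mass_density_def velocity_def)

lemma potential_eq:
  assumes "cv > 0" "U \<in> admissible cv pinf"
  shows "potential cv Gam pinf U =
    gas_const cv Gam * mass_density U - pinf / temperature cv pinf U"
proof -
  have T: "temperature cv pinf U \<noteq> 0" using assms by (simp add: admissible_def)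
  have alg: "(- S - (a\<^sup>2 + b\<^sup>2 + c\<^sup>2) / (2 * T) + cv * Gam) * \<rho>
      + a / T * (\<rho> * a) + b / T * (\<rho> * b) + c / T * (\<rho> * c)
      + - 1 / T * (cv * \<rho> * T + pinf + \<rho> * (a\<^sup>2 + b\<^sup>2 + c\<^sup>2) / 2) - - \<rho> * S
    = cv * (Gam - 1) * \<rho> - pinf / T" if "T \<noteq> 0" for S T \<rho> a b c :: real
    using that by (simp add: algebra_simps add_divide_distrib diff_divide_distrib power2_eq_square)
  have U1: "U $ 1 = mass_density U" and U5: "U $ 5 = total_energy U"
    by (simp_all add: mass_density_def total_energy_def)
  show ?thesis
    unfolding potential_def entropy_vars_eq[OF assms] inner_5 vector_5 U1 U5 norm_sq_3
      conserved_components[OF assms(2)] total_energy_eq[OF assms] entropy_def gas_const_def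
    by (rule alg[OF T])
qed

lemma potential_flux_eq:
  assumes "cv > 0" "U \<in> admissible cv pinf"
  shows "potential_flux cv Gam pinf k U = potential cv Gam pinf U * velocity U $ k"
proof -
  let ?v = "velocity U" and ?V = "entropy_vars cv Gam pinf U" and ?p = "pressure cv Gam pinf U"
  have T: "temperature cv pinf U \<noteq> 0" using assms by (simp add: admissible_def)
  have V: "?V $ 2 = ?v $ 1 / temperature cv pinf U" "?V $ 3 = ?v $ 2 / temperature cv pinf U"
    "?V $ 4 = ?v $ 3 / temperature cv pinf U" "?V $ 5 = - 1 / temperature cv pinf U"
    unfolding entropy_vars_eq[OF assms] by simp_all
  have U1: "U $ 1 = mass_density U" and U5: "U $ 5 = total_energy U"
    by (simp_all add: mass_density_def total_energy_def)
  have "?v $ 1 * axis k 1 $ 1 + ?v $ 2 * axis k 1 $ 2 + ?v $ 3 * axis k 1 $ 3 = ?v $ k"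
    using exhaust_3[of k] by (auto simp: axis_def)
  then have work: "?V $ 2 * (?p * axis k 1 $ 1) + ?V $ 3 * (?p * axis k 1 $ 2)
      + ?V $ 4 * (?p * axis k 1 $ 3) + ?V $ 5 * (?p * ?v $ k) = 0"
    using V by (simp flip: add_divide_distrib distrib_left add: mult.left_commute[of _ ?p])
  have "?V \<bullet> flux cv Gam pinf k U = (?V \<bullet> U) * ?v $ k
      + (?V $ 2 * (?p * axis k 1 $ 1) + ?V $ 3 * (?p * axis k 1 $ 2)
      + ?V $ 4 * (?p * axis k 1 $ 3) + ?V $ 5 * (?p * ?v $ k))"
    unfolding inner_5 flux_def Let_def vector_5 U1 U5 conserved_components[OF assms(2)]
    by (simp add: algebra_simps)
  then show ?thesis
    unfolding work potential_flux_def potential_def entropy_flux_def by (simp add: algebra_simps)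
qed

end

theory Submission
  imports Defs
begin

text \<open>
  Write \<open>\<beta> = 1 / T\<close>, \<open>[a] = a\<^sub>r - a\<^sub>l\<close> for the jump of a quantity and \<open>{a}\<close>, \<open>{a}\<^sup>l\<^sup>n\<close> for its
  arithmetic and logarithmic means. In terms of \<open>\<beta>\<close>,
  the entropy variables and the potential become
  \<open>V = (cv ln \<beta> + R ln \<rho> - \<beta> |v|\<^sup>2 / 2 + cv \<Gamma>, \<beta> v, - \<beta>)\<close> and \<open>\<phi> = R \<rho> - pinf \<beta>\<close>.
  Everything is then discrete calculus with two rules: the logarithmic mean is the one for which
  \<open>[ln a] = [a] / {a}\<^sup>l\<^sup>n\<close>, and the arithmetic mean is the one for which \<open>[a b] = {a} [b] + {b} [a]\<close>.

  \<^item> For the conserved variables, multiplying \<open>[V]\<close> by \<open>U_tilde\<close> gives \<open>R [\<rho>]\<close> from the term \<open>R ln \<rho>\<close>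
    and \<open>- pinf [\<beta>]\<close> from the energy component. The term \<open>cv ln \<beta>\<close> cancels against the thermal energy
    \<open>cv / {\<beta>}\<^sup>l\<^sup>n\<close>, and the velocity terms cancel one velocity component at a time
    (\<open>kinetic_jump\<close>). What remains is \<open>[\<phi>]\<close>.

  \<^item> For the flux, \<open>F1_tilde = {v\<^sub>1} U_tilde + P (e\<^sub>2 + {v\<^sub>1} e\<^sub>5)\<close> with the mean pressure
    \<open>P = R {\<rho>} / {\<beta>} - pinf\<close>, exactly as the Euler flux is convection with velocity \<open>v\<^sub>1\<close> plus
    pressure terms (\<open>F1_tilde_split\<close>, \<open>flux_split\<close>). Hence
    \<open>[V] \<bullet> F1_tilde = {v\<^sub>1} [\<phi>] + P ([\<beta> v\<^sub>1] - {v\<^sub>1} [\<beta>]) = {v\<^sub>1} [\<phi>] + P {\<beta>} [v\<^sub>1]\<close>, and since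
    \<open>P {\<beta>} = {\<phi>}\<close> this is \<open>[\<phi> v\<^sub>1]\<close>, the jump of the potential flux.

  The same splitting reduces consistency of the flux to consistency of \<open>U_tilde\<close>, which is the
  energy equation of state.
\<close>

section \<open>Jumps and means\<close>

lemma arith_mean_commute: "arith_mean a b = arith_mean b a"
  by (simp add: arith_mean_def)

lemma arith_mean_same [simp]: "arith_mean a a = a"
  by (simp add: arith_mean_def)

lemma log_mean_commute: "log_mean a b = log_mean b a"
  by (simp add: log_mean_def) (metis minus_diff_eq minus_divide_divide)

lemma log_mean_same [simp]: "log_mean a a = a"
  by (simp add: log_mean_def)

lemma log_mean_jump:
  assumes "a > 0" "b > 0"
  shows "log_mean a b * (ln b - ln a) = b - a"
  using assms by (auto simp: log_mean_def)

lemma log_mean_nonzero: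
  assumes "a > 0" "b > 0"
  shows "log_mean a b \<noteq> 0"
  using assms by (auto simp: log_mean_def)

lemma jump_mult:
  "b * y - a * x = arith_mean a b * (y - x) + arith_mean x y * (b - a)"
  by (simp add: arith_mean_def field_simps)

text \<open>
  Both sides come from the product rule: the contributions of \<open>[v]\<close> to \<open>{v} [\<beta> v]\<close> and to
  \<open>[\<beta> v\<^sup>2] / 2\<close> are both \<open>{v} {\<beta>} [v]\<close>, so only a multiple of \<open>[\<beta>]\<close> survives. Its
  coefficient is the kinetic energy per unit mass that \<open>U_tilde\<close> assigns to this velocity component.
\<close>
lemma kinetic_jump:
  "arith_mean x y * (b * y - a * x) - (b * y\<^sup>2 - a * x\<^sup>2) / 2
    = (b - a) * ((arith_mean x y)\<^sup>2 - arith_mean (x\<^sup>2) (y\<^sup>2) / 2)"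
  by (simp add: arith_mean_def power2_eq_square field_simps)

section \<open>States and entropy variables in terms of the inverse temperature\<close>

lemma vec_eq_iff_5:
  "x = y \<longleftrightarrow> x $ 1 = y $ 1 \<and> x $ 2 = y $ 2 \<and> x $ 3 = y $ 3 \<and> x $ 4 = y $ 4 \<and> x $ 5 = y $ 5"
  for x y :: "real^5"
proof -
  have "x = y \<longleftrightarrow> (\<forall>i\<in>UNIV. x $ i = y $ i)"
    by (simp add: vec_eq_iff)
  then show ?thesis
    unfolding UNIV_5 by simp
qed

lemma zvars_component [simp]:
  "zvars cv pinf U $ 1 = mass_density U"
  "zvars cv pinf U $ 2 = velocity U $ 1"
  "zvars cv pinf U $ 3 = velocity U $ 2"
  "zvars cv pinf U $ 4 = velocity U $ 3"
  "zvars cv pinf U $ 5 = 1 / temperature cv pinf U"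
  by (simp_all add: zvars_def)

lemma zvars_pos:
  assumes "U \<in> admissible cv pinf"
  shows "zvars cv pinf U $ 1 > 0" "zvars cv pinf U $ 5 > 0"
  using assms by (simp_all add: admissible_def)

lemma U_tilde_component:
  fixes cv pinf Ul Ur
  defines "z \<equiv> mean_z cv pinf Ul Ur" and "zsq \<equiv> mean_z_sq cv pinf Ul Ur"
    and "zln \<equiv> log_mean_z cv pinf Ul Ur"
  shows "U_tilde cv pinf Ul Ur $ 1 = zln 1"
    "U_tilde cv pinf Ul Ur $ 2 = z 2 * zln 1"
    "U_tilde cv pinf Ul Ur $ 3 = z 3 * zln 1"
    "U_tilde cv pinf Ul Ur $ 4 = z 4 * zln 1"
    "U_tilde cv pinf Ul Ur $ 5 = zln 1 * (cv / zln 5 + ((z 2)\<^sup>2 - zsq 2 / 2)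
      + ((z 3)\<^sup>2 - zsq 3 / 2) + ((z 4)\<^sup>2 - zsq 4 / 2)) + pinf"
  by (simp_all add: U_tilde_def Let_def z_def zsq_def zln_def algebra_simps add_divide_distrib)

lemma entropy_vars_component:
  fixes cv Gam pinf U
  assumes "cv > 0" "U \<in> admissible cv pinf"
  defines "z \<equiv> zvars cv pinf U" and "V \<equiv> entropy_vars cv Gam pinf U"
  shows "V $ 1 = cv * ln (z $ 5) + gas_const cv Gam * ln (z $ 1)
      - z $ 5 * ((z $ 2)\<^sup>2 + (z $ 3)\<^sup>2 + (z $ 4)\<^sup>2) / 2 + cv * Gam"
    "V $ 2 = z $ 5 * z $ 2" "V $ 3 = z $ 5 * z $ 3" "V $ 4 = z $ 5 * z $ 4" "V $ 5 = - z $ 5"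
proof -
  have "temperature cv pinf U > 0"
    using assms(2) by (simp add: admissible_def)
  then show "V $ 1 = cv * ln (z $ 5) + gas_const cv Gam * ln (z $ 1)
      - z $ 5 * ((z $ 2)\<^sup>2 + (z $ 3)\<^sup>2 + (z $ 4)\<^sup>2) / 2 + cv * Gam"
    by (simp add: V_def z_def entropy_vars_eq[OF assms(1,2)] thermo_entropy_def norm_sq_3 ln_div)
qed (simp_all add: V_def z_def entropy_vars_eq[OF assms(1,2)])

lemma potential_zvars:
  assumes "cv > 0" "U \<in> admissible cv pinf"
  shows "potential cv Gam pinf U
    = gas_const cv Gam * zvars cv pinf U $ 1 - pinf * zvars cv pinf U $ 5"
  by (simp add: potential_eq[OF assms])

section \<open>Convection and pressure\<close>

definition mean_pressure :: "real \<Rightarrow> real \<Rightarrow> real \<Rightarrow> real^5 \<Rightarrow> real^5 \<Rightarrow> real" where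
  "mean_pressure cv Gam pinf Ul Ur =
    gas_const cv Gam * mean_z cv pinf Ul Ur 1 / mean_z cv pinf Ul Ur 5 - pinf"

text \<open>
  In the energy component, convection of \<open>U_tilde\<close> already transports the constant \<open>pinf\<close> with velocity
  \<open>mean_z cv pinf Ul Ur 2\<close>, which accounts for the separate last term in the definition of the flux.
\<close>
lemma F1_tilde_split:
  fixes cv Gam pinf Ul Ur
  defines "w \<equiv> mean_z cv pinf Ul Ur 2" and "P \<equiv> mean_pressure cv Gam pinf Ul Ur"
  shows "F1_tilde cv Gam pinf Ul Ur = w *\<^sub>R U_tilde cv pinf Ul Ur + vector [0, P, 0, 0, w * P]"
  unfolding vec_eq_iff_5
  by (simp add: F1_tilde_def U_tilde_def Let_def w_def P_def mean_pressure_def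
      algebra_simps power2_eq_square)

lemma flux_split:
  fixes cv Gam pinf U
  assumes "U \<in> admissible cv pinf"
  defines "w \<equiv> velocity U $ 1" and "p \<equiv> pressure cv Gam pinf U"
  shows "flux cv Gam pinf 1 U = w *\<^sub>R U + vector [0, p, 0, 0, w * p]"
  using conserved_components[OF assms(1)] unfolding vec_eq_iff_5
  by (simp add: flux_def Let_def axis_def w_def p_def mass_density_def total_energy_def
      algebra_simps)

section \<open>Consistency\<close>

lemma U_tilde_consistent:
  assumes "cv > 0" "U \<in> admissible cv pinf"
  shows "U_tilde cv pinf U U = U"
proof -
  have "U $ 1 = mass_density U" "U $ 5 = total_energy U"
    by (simp_all add: mass_density_def total_energy_def)
  then show ?thesis
    unfolding vec_eq_iff_5 U_tilde_component
    by (simp add: mean_z_def mean_z_sq_def log_mean_z_def conserved_components[OF assms(2)]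
        total_energy_eq[OF assms] norm_sq_3 field_simps)
qed

lemma F1_tilde_consistent:
  assumes "cv > 0" "U \<in> admissible cv pinf"
  shows "F1_tilde cv Gam pinf U U = flux cv Gam pinf 1 U"
  by (simp add: F1_tilde_split flux_split[OF assms(2)] U_tilde_consistent[OF assms]
      mean_pressure_def pressure_def mean_z_def mult.commute mult.left_commute)

section \<open>Symmetry\<close>

lemma means_commute:
  "mean_z cv pinf Ul Ur = mean_z cv pinf Ur Ul"
  "mean_z_sq cv pinf Ul Ur = mean_z_sq cv pinf Ur Ul"
  "log_mean_z cv pinf Ul Ur = log_mean_z cv pinf Ur Ul"
  unfolding fun_eq_iff mean_z_def mean_z_sq_def log_mean_z_def
  by (intro allI arith_mean_commute log_mean_commute)+

lemma U_tilde_commute: "U_tilde cv pinf Ul Ur = U_tilde cv pinf Ur Ul"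
  unfolding U_tilde_def means_commute[of cv pinf Ul Ur] ..

lemma F1_tilde_commute: "F1_tilde cv Gam pinf Ul Ur = F1_tilde cv Gam pinf Ur Ul"
  unfolding F1_tilde_def means_commute[of cv pinf Ul Ur] ..

section \<open>Entropy conservation\<close>

lemma U_tilde_entropy_conservative:
  assumes cv: "cv > 0" and Ul: "Ul \<in> admissible cv pinf" and Ur: "Ur \<in> admissible cv pinf"
  shows "(entropy_vars cv Gam pinf Ur - entropy_vars cv Gam pinf Ul) \<bullet> U_tilde cv pinf Ul Ur
    = potential cv Gam pinf Ur - potential cv Gam pinf Ul"
proof -
  let ?R = "gas_const cv Gam"
  let ?l = "zvars cv pinf Ul" and ?r = "zvars cv pinf Ur"
  define z where "z = mean_z cv pinf Ul Ur"
  define zsq where "zsq = mean_z_sq cv pinf Ul Ur"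
  define zln where "zln = log_mean_z cv pinf Ul Ur"
  define J where "J m = z m * (?r $ 5 * ?r $ m - ?l $ 5 * ?l $ m)
    - (?r $ 5 * (?r $ m)\<^sup>2 - ?l $ 5 * (?l $ m)\<^sup>2) / 2" for m
  note pos = zvars_pos[OF Ul] zvars_pos[OF Ur]
  have ln_rho: "zln 1 * (ln (?r $ 1) - ln (?l $ 1)) = ?r $ 1 - ?l $ 1"
    unfolding zln_def log_mean_z_def by (rule log_mean_jump) (fact pos)+
  have "zln 5 * (ln (?r $ 5) - ln (?l $ 5)) = ?r $ 5 - ?l $ 5" "zln 5 \<noteq> 0"
    unfolding zln_def log_mean_z_def
    by (rule log_mean_jump log_mean_nonzero, fact pos, fact pos)+
  then have ln_beta: "ln (?r $ 5) - ln (?l $ 5) = (?r $ 5 - ?l $ 5) / zln 5"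
    by (simp add: eq_divide_eq mult.commute)
  have J: "J m = (?r $ 5 - ?l $ 5) * ((z m)\<^sup>2 - zsq m / 2)" for m
    unfolding J_def z_def zsq_def mean_z_def mean_z_sq_def by (rule kinetic_jump)
  have "(entropy_vars cv Gam pinf Ur - entropy_vars cv Gam pinf Ul) \<bullet> U_tilde cv pinf Ul Ur
    = zln 1 * (cv * (ln (?r $ 5) - ln (?l $ 5)) + J 2 + J 3 + J 4)
      + ?R * (zln 1 * (ln (?r $ 1) - ln (?l $ 1)))
      - (?r $ 5 - ?l $ 5) * (zln 1 * (cv / zln 5 + ((z 2)\<^sup>2 - zsq 2 / 2)
        + ((z 3)\<^sup>2 - zsq 3 / 2) + ((z 4)\<^sup>2 - zsq 4 / 2)) + pinf)"
    unfolding inner_5 vector_minus_component U_tilde_component J_def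
      entropy_vars_component[OF cv Ul] entropy_vars_component[OF cv Ur]
      z_def[symmetric] zsq_def[symmetric] zln_def[symmetric]
    by (simp only: ring_distribs diff_divide_distrib add_divide_distrib mult_minus_left
        mult_minus_right times_divide_eq_right times_divide_eq_left ac_simps)
  also have "\<dots> = ?R * (?r $ 1 - ?l $ 1) - pinf * (?r $ 5 - ?l $ 5)"
    unfolding J ln_rho ln_beta by (simp add: algebra_simps diff_divide_distrib)
  also have "\<dots> = potential cv Gam pinf Ur - potential cv Gam pinf Ul"
    unfolding potential_zvars[OF cv Ul] potential_zvars[OF cv Ur] by (simp add: algebra_simps)
  finally show ?thesis .
qed

text \<open>
  This choice of mean pressure is what makes the pressure work supply the half of the product rule
  for \<open>potential * velocity\<close> that convection leaves out.
\<close>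
lemma mean_pressure_potential:
  assumes cv: "cv > 0" and Ul: "Ul \<in> admissible cv pinf" and Ur: "Ur \<in> admissible cv pinf"
  shows "mean_pressure cv Gam pinf Ul Ur * mean_z cv pinf Ul Ur 5
    = arith_mean (potential cv Gam pinf Ul) (potential cv Gam pinf Ur)"
proof -
  have "mean_z cv pinf Ul Ur 5 > 0"
    unfolding mean_z_def arith_mean_def
    by (intro half_gt_zero add_pos_pos zvars_pos(2) Ul Ur)
  then have "mean_pressure cv Gam pinf Ul Ur * mean_z cv pinf Ul Ur 5
    = gas_const cv Gam * mean_z cv pinf Ul Ur 1 - pinf * mean_z cv pinf Ul Ur 5"
    by (simp add: mean_pressure_def left_diff_distrib)
  also have "\<dots> = arith_mean (potential cv Gam pinf Ul) (potential cv Gam pinf Ur)"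
    unfolding potential_zvars[OF cv Ul] potential_zvars[OF cv Ur] mean_z_def arith_mean_def
    by argo
  finally show ?thesis .
qed

lemma F1_tilde_entropy_conservative:
  assumes cv: "cv > 0" and Ul: "Ul \<in> admissible cv pinf" and Ur: "Ur \<in> admissible cv pinf"
  shows "(entropy_vars cv Gam pinf Ur - entropy_vars cv Gam pinf Ul) \<bullet> F1_tilde cv Gam pinf Ul Ur
    = potential_flux cv Gam pinf 1 Ur - potential_flux cv Gam pinf 1 Ul"
proof -
  let ?V = "entropy_vars cv Gam pinf" and ?\<phi> = "potential cv Gam pinf"
  let ?l = "zvars cv pinf Ul" and ?r = "zvars cv pinf Ur"
  define w where "w = mean_z cv pinf Ul Ur 2"
  define b where "b = mean_z cv pinf Ul Ur 5"
  define P where "P = mean_pressure cv Gam pinf Ul Ur"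
  have "(?V Ur - ?V Ul) \<bullet> F1_tilde cv Gam pinf Ul Ur
    = w * ((?V Ur - ?V Ul) \<bullet> U_tilde cv pinf Ul Ur)
      + (?V Ur - ?V Ul) \<bullet> vector [0, P, 0, 0, w * P]"
    unfolding F1_tilde_split w_def P_def by (simp only: inner_add_right inner_scaleR_right)
  also have "(?V Ur - ?V Ul) \<bullet> vector [0, P, 0, 0, w * P]
    = P * ((?r $ 5 * ?r $ 2 - ?l $ 5 * ?l $ 2) - w * (?r $ 5 - ?l $ 5))"
    unfolding inner_5 vector_minus_component vector_5
      entropy_vars_component[OF cv Ul] entropy_vars_component[OF cv Ur]
    by (simp only: algebra_simps mult_zero_right add_0_left add_0_right)
  also have "?r $ 5 * ?r $ 2 - ?l $ 5 * ?l $ 2 = b * (?r $ 2 - ?l $ 2) + w * (?r $ 5 - ?l $ 5)"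
    unfolding b_def w_def mean_z_def by (rule jump_mult)
  also have "P * (b * (?r $ 2 - ?l $ 2) + w * (?r $ 5 - ?l $ 5) - w * (?r $ 5 - ?l $ 5))
    = arith_mean (?\<phi> Ul) (?\<phi> Ur) * (?r $ 2 - ?l $ 2)"
    unfolding mean_pressure_potential[OF cv Ul Ur, symmetric] P_def b_def by simp
  also have "w * ((?V Ur - ?V Ul) \<bullet> U_tilde cv pinf Ul Ur) = w * (?\<phi> Ur - ?\<phi> Ul)"
    unfolding U_tilde_entropy_conservative[OF cv Ul Ur] ..
  also have "w * (?\<phi> Ur - ?\<phi> Ul) + arith_mean (?\<phi> Ul) (?\<phi> Ur) * (?r $ 2 - ?l $ 2)
    = ?\<phi> Ur * ?r $ 2 - ?\<phi> Ul * ?l $ 2"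
    unfolding w_def mean_z_def jump_mult[of "?\<phi> Ur"] by (rule add.commute)
  also have "\<dots> = potential_flux cv Gam pinf 1 Ur - potential_flux cv Gam pinf 1 Ul"
    by (simp add: potential_flux_eq[OF cv Ul] potential_flux_eq[OF cv Ur])
  finally show ?thesis .
qed

theorem mainTheorem1:
  fixes cv Gam pinf :: real
  assumes "cv > 0"
  shows "(\<forall>U \<in> admissible cv pinf.
      U_tilde cv pinf U U = U \<and> F1_tilde cv Gam pinf U U = flux cv Gam pinf 1 U) \<and>
    (\<forall>Ul \<in> admissible cv pinf. \<forall>Ur \<in> admissible cv pinf.
      U_tilde cv pinf Ul Ur = U_tilde cv pinf Ur Ul \<and>
      F1_tilde cv Gam pinf Ul Ur = F1_tilde cv Gam pinf Ur Ul \<and>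
      (entropy_vars cv Gam pinf Ur - entropy_vars cv Gam pinf Ul) \<bullet> U_tilde cv pinf Ul Ur
        = potential cv Gam pinf Ur - potential cv Gam pinf Ul \<and>
      (entropy_vars cv Gam pinf Ur - entropy_vars cv Gam pinf Ul) \<bullet> F1_tilde cv Gam pinf Ul Ur
        = potential_flux cv Gam pinf 1 Ur - potential_flux cv Gam pinf 1 Ul)"
  by (intro conjI ballI U_tilde_consistent F1_tilde_consistent U_tilde_commute F1_tilde_commute
      U_tilde_entropy_conservative F1_tilde_entropy_conservative assms)

end
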